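(* Let $k\ge 3$, let $Q$ be a simple $k$-regular graph and let $H=S(Q)$ be its subdivision graph. Define $\mu_k(Q)$ to be the minimum of $|X|$ over all subsets $X\subseteq V(Q)$ for which there exist maps $c:E(Q)\to[k]$ and $\ell:X\to[k]$ such that (i) for every $a\in V(Q)\setminus X$, $\{c(e):e\ni a\}=[k]$ (i.e. the $k$ edges incident to $a$ have pairwise distinct colours); (ii) for every $x\in X$, $c(e)\ne\ell(x)$ for every edge $e\ni x$. Then $$\gamma_{\mathrm{ri},k}(H)=|E(Q)|+\mu_k(Q).$$ Consequently, with $\delta_k(Q)=\gamma_{\mathrm{ri},k}(S(Q))-|E(Q)|$, one has $\delta_k(Q)=\mu_k(Q)\ge 0$, and $\delta_k(Q)=0\iff\chi'(Q)=k$. In particular $0\le\delta_k(Q)\le|V(Q)|$.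
   Context: All graphs are finite, simple and undirected. Write $[k]=\{1,\dots,k\}$. A per-colour independent $k$-rainbow dominating function ($k$-RiDF) of a graph $G$ is a function $f:V(G)\to 2^{[k]}$ such that: (i) $|f(v)|\le 1$ for every $v$; (ii) for every $i\in[k]$ the set $V_i=\{v:f(v)=\{i\}\}$ is independent in $G$ (the union of the $V_i$ need not be independent); (iii) for every $v$ with $f(v)=\emptyset$, $\bigcup_{u\in N(v)}f(u)=[k]$, where $N(v)$ is the open neighbourhood. The weight of $f$ is $\sum_{v\in V(G)}|f(v)|$, and $\gamma_{\mathrm{ri},k}(G)$ is the minimum weight of a $k$-RiDF of $G$. The subdivision graph $S(Q)$ of a graph $Q$ has vertex set $V(Q)\cup E(Q)$ (disjoint union), with $a\in V(Q)$ adjacent to $e\in E(Q)$ exactly when $a$ is an endpoint of $e$, and no other edges. The map $c$ is an arbitrary (not necessarily proper) assignment of colours to edges. $\chi'(Q)$ is the chromatic index. *)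

theory Defs
  imports "HOL-Library.FuncSet"
begin

record 'a ugraph =
  verts :: "'a set"
  edges :: "'a set set"

definition simple_graph :: "'a ugraph \<Rightarrow> bool" where
  "simple_graph G \<longleftrightarrow> finite (verts G) \<and> (\<forall>e\<in>edges G. e \<subseteq> verts G \<and> card e = 2)"

definition neighbours :: "'a ugraph \<Rightarrow> 'a \<Rightarrow> 'a set" where
  "neighbours G v = {u \<in> verts G. {u, v} \<in> edges G}"

definition incident_edges :: "'a ugraph \<Rightarrow> 'a \<Rightarrow> 'a set set" where
  "incident_edges G v = {e \<in> edges G. v \<in> e}"

definition independent :: "'a ugraph \<Rightarrow> 'a set \<Rightarrow> bool" where
  "independent G S \<longleftrightarrow> S \<subseteq> verts G \<and> (\<forall>u\<in>S. \<forall>v\<in>S. {u, v} \<notin> edges G)"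

definition regular :: "nat \<Rightarrow> 'a ugraph \<Rightarrow> bool" where
  "regular k G \<longleftrightarrow> (\<forall>v\<in>verts G. card (neighbours G v) = k)"

definition subdivision :: "'a ugraph \<Rightarrow> ('a + 'a set) ugraph" where
  "subdivision Q =
     \<lparr> verts = verts Q <+> edges Q,
       edges = {{Inl a, Inr e} | a e. a \<in> verts Q \<and> e \<in> edges Q \<and> a \<in> e} \<rparr>"

definition proper_edge_colouring :: "'a ugraph \<Rightarrow> nat \<Rightarrow> ('a set \<Rightarrow> nat) \<Rightarrow> bool" where
  "proper_edge_colouring G m c \<longleftrightarrow>
     c \<in> edges G \<rightarrow> {1..m} \<and>
     (\<forall>e\<in>edges G. \<forall>e'\<in>edges G. e \<noteq> e' \<and> e \<inter> e' \<noteq> {} \<longrightarrow> c e \<noteq> c e')"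

definition chromatic_index :: "'a ugraph \<Rightarrow> nat" where
  "chromatic_index G = (LEAST m. \<exists>c. proper_edge_colouring G m c)"

definition RiDF :: "nat \<Rightarrow> 'a ugraph \<Rightarrow> ('a \<Rightarrow> nat set) \<Rightarrow> bool" where
  "RiDF k G f \<longleftrightarrow>
     (\<forall>v\<in>verts G. f v \<subseteq> {1..k}) \<and>
     (\<forall>v\<in>verts G. card (f v) \<le> 1) \<and>
     (\<forall>i\<in>{1..k}. independent G {v \<in> verts G. f v = {i}}) \<and>
     (\<forall>v\<in>verts G. f v = {} \<longrightarrow> (\<Union>u\<in>neighbours G v. f u) = {1..k})"

definition weight :: "'a ugraph \<Rightarrow> ('a \<Rightarrow> nat set) \<Rightarrow> nat" where
  "weight G f = (\<Sum>v\<in>verts G. card (f v))"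

definition gamma_ri :: "nat \<Rightarrow> 'a ugraph \<Rightarrow> nat" where
  "gamma_ri k G = (LEAST w. \<exists>f. RiDF k G f \<and> weight G f = w)"

definition mu_admissible :: "nat \<Rightarrow> 'a ugraph \<Rightarrow> 'a set \<Rightarrow> bool" where
  "mu_admissible k Q X \<longleftrightarrow>
     X \<subseteq> verts Q \<and>
     (\<exists>c \<in> edges Q \<rightarrow> {1..k}. \<exists>l \<in> X \<rightarrow> {1..k}.
        (\<forall>a \<in> verts Q - X. c ` incident_edges Q a = {1..k}) \<and>
        (\<forall>x \<in> X. \<forall>e \<in> incident_edges Q x. c e \<noteq> l x))"

definition mu :: "nat \<Rightarrow> 'a ugraph \<Rightarrow> nat" where
  "mu k Q = (LEAST n. \<exists>X. mu_admissible k Q X \<and> card X = n)"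

text \<open>The difference is taken in the integers, so that its nonnegativity is not automatic.\<close>

definition delta :: "nat \<Rightarrow> 'a ugraph \<Rightarrow> int" where
  "delta k Q = int (gamma_ri k (subdivision Q)) - int (card (edges Q))"

text \<open>The sets of values minimised by \<^const>\<open>chromatic_index\<close>, \<^const>\<open>gamma_ri\<close> and
  \<^const>\<open>mu\<close> are nonempty, so each LEAST denotes a genuine minimum.\<close>

lemma simple_graph_finite_edges:
  assumes "simple_graph G"
  shows "finite (edges G)"
  by (rule finite_subset[of _ "Pow (verts G)"]) (use assms in \<open>auto simp: simple_graph_def\<close>)

lemma simple_graph_subdivision:
  assumes "simple_graph Q"
  shows "simple_graph (subdivision Q)"
  using assms simple_graph_finite_edges[OF assms]
  by (auto simp: simple_graph_def subdivision_def)

lemma ex_proper_edge_colouring: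
  assumes "simple_graph G"
  shows "\<exists>m c. proper_edge_colouring G m c"
proof -
  obtain c where "bij_betw c (edges G) {1..card (edges G)}"
    using simple_graph_finite_edges[OF assms] finite_same_card_bij[of "edges G" "{1..card (edges G)}"]
    by auto
  then have "proper_edge_colouring G (card (edges G)) c"
    unfolding proper_edge_colouring_def bij_betw_def inj_on_def by auto
  then show ?thesis by blast
qed

lemma ex_RiDF:
  assumes G: "simple_graph G"
  shows "\<exists>f. RiDF k G f"
proof -
  define P where "P S f \<longleftrightarrow> S \<subseteq> verts G \<and> (\<forall>v\<in>S. \<exists>i\<in>{1..k}. f v = {i}) \<and>
      (\<forall>v. v \<notin> S \<longrightarrow> f v = {}) \<and> (\<forall>u v. {u, v} \<in> edges G \<longrightarrow> f u \<inter> f v = {})"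
    for S and f :: "'a \<Rightarrow> nat set"
  have fin: "finite (verts G)" using G by (simp add: simple_graph_def)
  have "\<exists>f. P {} f" by (auto simp: P_def intro!: exI[of _ "\<lambda>_. {}"])
  moreover have "\<forall>S. (\<exists>f. P S f) \<longrightarrow> card S < Suc (card (verts G))"
    using card_mono[OF fin] by (auto simp: P_def less_Suc_eq_le)
  ultimately have "\<exists>S. (\<exists>f. P S f) \<and> (\<forall>T. (\<exists>f. P T f) \<longrightarrow> card T \<le> card S)"
    by (rule ex_has_greatest_nat)
  then obtain S where S: "\<exists>f. P S f" and max: "\<And>T. \<exists>f. P T f \<Longrightarrow> card T \<le> card S"
    by blast
  from S obtain f where f: "P S f" by blast
  have "(\<Union>u\<in>neighbours G v. f u) = {1..k}" if v: "v \<in> verts G" "f v = {}" for v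
  proof (rule ccontr)
    assume neq: "(\<Union>u\<in>neighbours G v. f u) \<noteq> {1..k}"
    have "f u \<subseteq> {1..k}" for u using f by (cases "u \<in> S") (auto simp: P_def)
    with neq obtain i where i: "i \<in> {1..k}" "\<And>u. u \<in> neighbours G v \<Longrightarrow> i \<notin> f u" by blast
    have vS: "v \<notin> S" using f v by (auto simp: P_def)
    have noloop: "{v, v} \<notin> edges G" using G by (force simp: simple_graph_def)
    have nb: "u \<in> neighbours G v" if "{u, v} \<in> edges G \<or> {v, u} \<in> edges G" for u
      using that G by (auto simp: neighbours_def simple_graph_def insert_commute)
    have "P (insert v S) (f(v := {i}))"
      using f v i nb noloop unfolding P_def by auto
    then have "card (insert v S) \<le> card S" using max by blast
    moreover have "finite S" using f fin by (auto simp: P_def intro: finite_subset)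
    ultimately show False using vS by simp
  qed
  moreover have "f v \<subseteq> {1..k} \<and> card (f v) \<le> 1" for v
    using f by (cases "v \<in> S") (auto simp: P_def)
  moreover have "independent G {v \<in> verts G. f v = {i}}" for i
    using f by (fastforce simp: P_def independent_def)
  ultimately have "RiDF k G f" by (simp add: RiDF_def)
  then show ?thesis by blast
qed

lemma mu_admissible_verts:
  assumes "k \<ge> 2"
  shows "mu_admissible k Q (verts Q)"
  unfolding mu_admissible_def
  by (intro conjI subset_refl bexI[of _ "\<lambda>_. 1"] bexI[of _ "\<lambda>_. 2"]) (use assms in auto)

end

(* An edge vertex of S(Q) has only two neighbours, each carrying at most one colour, so for k \<ge> 3 it
   cannot be empty in a k-RiDF f. Hence f restricts to an edge colouring c, and with X the set of
   nonempty original vertices, coloured by l, the RiDF conditions are exactly the admissibility of X,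
   while the weight is |E(Q)| + |X|. An admissible X = {} amounts to an edge colouring in which all k
   colours occur among the k edges at every vertex, that is, to a proper k-edge-colouring. *)

theory Submission
  imports Defs
begin

section \<open>Adjacency, independence and weight in the subdivision graph\<close>

lemma verts_subdivision [simp]: "verts (subdivision Q) = verts Q <+> edges Q"
  by (simp add: subdivision_def)

lemma subdivision_edge_iff [simp]:
  "{Inl a, Inr e} \<in> edges (subdivision Q) \<longleftrightarrow> a \<in> verts Q \<and> e \<in> edges Q \<and> a \<in> e"
  "{Inr e, Inl a} \<in> edges (subdivision Q) \<longleftrightarrow> a \<in> verts Q \<and> e \<in> edges Q \<and> a \<in> e"
  "{Inl a, Inl b} \<notin> edges (subdivision Q)"
  "{Inr e, Inr e'} \<notin> edges (subdivision Q)"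
  by (auto simp: subdivision_def doubleton_eq_iff)

lemma neighbours_subdivision_Inl:
  assumes "a \<in> verts Q"
  shows "neighbours (subdivision Q) (Inl a) = Inr ` incident_edges Q a"
  using assms by (auto simp: neighbours_def incident_edges_def)

lemma neighbours_subdivision_Inr:
  assumes "simple_graph Q" "e \<in> edges Q"
  shows "neighbours (subdivision Q) (Inr e) = Inl ` e"
proof -
  have "e \<subseteq> verts Q" using assms by (simp add: simple_graph_def)
  then show ?thesis using assms(2) by (auto simp: neighbours_def)
qed

text \<open>The subdivision graph is bipartite, so only a mixed pair can be adjacent. For a colour
  class this is the condition that an edge avoids the label of its endpoint.\<close>

lemma independent_subdivision_iff:
  "independent (subdivision Q) S \<longleftrightarrow>
     S \<subseteq> verts Q <+> edges Q \<and> (\<forall>a e. Inl a \<in> S \<longrightarrow> Inr e \<in> S \<longrightarrow> a \<notin> e)"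
proof
  assume S: "independent (subdivision Q) S"
  then have sub: "S \<subseteq> verts Q <+> edges Q" by (simp add: independent_def)
  have "a \<notin> e" if "Inl a \<in> S" "Inr e \<in> S" for a e
  proof -
    have "{Inl a, Inr e} \<notin> edges (subdivision Q)"
      using S that unfolding independent_def by blast
    with sub that show ?thesis by auto
  qed
  with sub show "S \<subseteq> verts Q <+> edges Q \<and> (\<forall>a e. Inl a \<in> S \<longrightarrow> Inr e \<in> S \<longrightarrow> a \<notin> e)"
    by blast
next
  assume S: "S \<subseteq> verts Q <+> edges Q \<and> (\<forall>a e. Inl a \<in> S \<longrightarrow> Inr e \<in> S \<longrightarrow> a \<notin> e)"
  have "{u, v} \<notin> edges (subdivision Q)" if "u \<in> S" "v \<in> S" for u v
    using S that by (cases u; cases v) auto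
  with S show "independent (subdivision Q) S"
    by (simp add: independent_def)
qed

text \<open>Regularity counts neighbours, while colourings speak of incident edges; sending
  \<open>u\<close> to \<open>{u, v}\<close> is the bijection between the two.\<close>

lemma card_incident_edges:
  assumes "simple_graph G"
  shows "card (incident_edges G v) = card (neighbours G v)"
proof -
  have "incident_edges G v \<subseteq> (\<lambda>u. {u, v}) ` neighbours G v"
  proof
    fix e assume e: "e \<in> incident_edges G v"
    then have "e \<subseteq> verts G" "card e = 2" "v \<in> e"
      using assms by (auto simp: incident_edges_def simple_graph_def)
    then obtain u where "e = {u, v}" by (auto simp: card_2_iff)
    then show "e \<in> (\<lambda>u. {u, v}) ` neighbours G v"
      using e \<open>e \<subseteq> verts G\<close> by (auto simp: incident_edges_def neighbours_def)
  qed
  then have "incident_edges G v = (\<lambda>u. {u, v}) ` neighbours G v"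
    by (auto simp: incident_edges_def neighbours_def)
  moreover have "inj_on (\<lambda>u. {u, v}) (neighbours G v)"
    by (auto simp: inj_on_def doubleton_eq_iff)
  ultimately show ?thesis by (simp add: card_image)
qed

lemma weight_subdivision:
  assumes "simple_graph Q"
  shows "weight (subdivision Q) f = (\<Sum>a\<in>verts Q. card (f (Inl a))) + (\<Sum>e\<in>edges Q. card (f (Inr e)))"
  using assms simple_graph_finite_edges[OF assms]
  by (simp add: weight_def sum.Plus simple_graph_def)

section \<open>Translation between rainbow dominating functions and admissible sets\<close>

lemma RiDF_dominated:
  "RiDF k G f \<Longrightarrow> v \<in> verts G \<Longrightarrow> f v = {} \<Longrightarrow> (\<Union>u\<in>neighbours G v. f u) = {1..k}"
  unfolding RiDF_def by blast

lemma RiDF_subdivision_edge_nonempty: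
  assumes "k \<ge> 3" "simple_graph Q" "RiDF k (subdivision Q) f" "e \<in> edges Q"
  shows "f (Inr e) \<noteq> {}"
proof
  assume "f (Inr e) = {}"
  then have "(\<Union>u\<in>Inl ` e. f u) = {1..k}"
    using RiDF_dominated[OF assms(3), of "Inr e"] assms(4) neighbours_subdivision_Inr[OF assms(2,4)]
    by (simp add: InrI)
  then have "k = card (\<Union>a\<in>e. f (Inl a))" by simp
  also have "\<dots> \<le> (\<Sum>a\<in>e. card (f (Inl a)))"
    \<comment> \<open>Finiteness of \<open>e\<close> is read off from \<open>card e = 2\<close>,
      since infinite sets have cardinality 0.\<close>
    using assms by (intro card_UN_le card_ge_0_finite) (simp add: simple_graph_def)
  also have "\<dots> \<le> (\<Sum>a\<in>e. 1)"
  proof (rule sum_mono)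
    fix a assume "a \<in> e"
    then have "Inl a \<in> verts (subdivision Q)" using assms by (auto simp: simple_graph_def)
    then show "card (f (Inl a)) \<le> 1" using assms(3) unfolding RiDF_def by blast
  qed
  also have "\<dots> = 2" using assms by (simp add: simple_graph_def)
  finally show False using \<open>k \<ge> 3\<close> by simp
qed

lemma card_le_1_nonempty:
  assumes "finite A" "card A \<le> 1" "A \<noteq> {}"
  shows "\<exists>x. A = {x}"
proof -
  have "card A = 1" using assms by (simp add: le_Suc_eq)
  then show ?thesis by (auto simp: card_1_singleton_iff)
qed

text \<open>Source of the lower bound on \<open>gamma_ri\<close>: an optimal \<open>f\<close> yields
  a set competing for \<open>mu\<close>, and the exact weight compares the two minima.\<close>

lemma RiDF_subdivision_imp_mu_admissible:
  assumes k: "k \<ge> 3" and Q: "simple_graph Q" and f: "RiDF k (subdivision Q) f"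
  obtains X where "mu_admissible k Q X" "weight (subdivision Q) f = card (edges Q) + card X"
proof -
  define X where "X = {a \<in> verts Q. f (Inl a) \<noteq> {}}"
  have single: "\<exists>i\<in>{1..k}. f v = {i}" if "v \<in> verts Q <+> edges Q" "f v \<noteq> {}" for v
  proof -
    have "f v \<subseteq> {1..k}" "card (f v) \<le> 1" using f that(1) by (auto simp: RiDF_def)
    \<comment> \<open>An infinite set would also pass \<open>card (f v) \<le> 1\<close>, so
      finiteness has to come from the palette \<open>{1..k}\<close>.\<close>
    moreover from this(1) have "finite (f v)" by (rule finite_subset) simp
    ultimately show ?thesis using that(2) card_le_1_nonempty[of "f v"] by auto
  qed
  have "\<forall>e\<in>edges Q. \<exists>i\<in>{1..k}. f (Inr e) = {i}"
    using single RiDF_subdivision_edge_nonempty[OF k Q f] by blast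
  then obtain c where c: "\<And>e. e \<in> edges Q \<Longrightarrow> c e \<in> {1..k} \<and> f (Inr e) = {c e}"
    by metis
  have "\<forall>a\<in>X. \<exists>i\<in>{1..k}. f (Inl a) = {i}"
    using single by (auto simp: X_def)
  then obtain l where l: "\<And>a. a \<in> X \<Longrightarrow> l a \<in> {1..k} \<and> f (Inl a) = {l a}"
    by metis
  \<comment> \<open>An uncoloured original vertex must see all colours, and its neighbours are
    exactly the edge vertices at \<open>a\<close>.\<close>
  have "c ` incident_edges Q a = {1..k}" if a: "a \<in> verts Q - X" for a
  proof -
    have "(\<Union>u\<in>Inr ` incident_edges Q a. f u) = {1..k}"
      using RiDF_dominated[OF f, of "Inl a"] a neighbours_subdivision_Inl[of a Q]
      by (simp add: X_def InlI)
    moreover have "(\<Union>u\<in>Inr ` incident_edges Q a. f u) = c ` incident_edges Q a"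
      using c by (auto simp: incident_edges_def)
    ultimately show ?thesis by simp
  qed
  moreover have "c e \<noteq> l x" if x: "x \<in> X" and e: "e \<in> incident_edges Q x" for x e
  proof
    \<comment> \<open>Then the adjacent vertices \<open>Inl x\<close> and \<open>Inr e\<close> would
      lie in one colour class.\<close>
    assume "c e = l x"
    moreover have "independent (subdivision Q) {v \<in> verts (subdivision Q). f v = {l x}}"
      using f l[OF x] by (auto simp: RiDF_def)
    ultimately show False
      using x e l[OF x] c[of e] by (auto simp: independent_subdivision_iff incident_edges_def X_def)
  qed
  moreover have "c \<in> edges Q \<rightarrow> {1..k}" "l \<in> X \<rightarrow> {1..k}" "X \<subseteq> verts Q"
    using c l by (auto simp: X_def)
  ultimately have "mu_admissible k Q X"
    unfolding mu_admissible_def by blast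
  moreover have "(\<Sum>a\<in>verts Q. card (f (Inl a))) = (\<Sum>a\<in>X. card (f (Inl a)))"
    using Q by (intro sum.mono_neutral_right) (auto simp: X_def simple_graph_def)
  then have "weight (subdivision Q) f = card (edges Q) + card X"
    using l c by (simp add: weight_subdivision[OF Q])
  ultimately show thesis by (rule that)
qed

text \<open>Source of the upper bound on \<open>gamma_ri\<close>, applied to an optimal
  \<open>X\<close>.\<close>

lemma mu_admissible_imp_RiDF_subdivision:
  assumes Q: "simple_graph Q" and X: "mu_admissible k Q X"
  obtains f where "RiDF k (subdivision Q) f" "weight (subdivision Q) f = card (edges Q) + card X"
proof -
  from X obtain c l where sub: "X \<subseteq> verts Q"
    and c: "c \<in> edges Q \<rightarrow> {1..k}" and l: "l \<in> X \<rightarrow> {1..k}"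
    and dom: "\<And>a. a \<in> verts Q - X \<Longrightarrow> c ` incident_edges Q a = {1..k}"
    and ind: "\<And>x e. x \<in> X \<Longrightarrow> e \<in> incident_edges Q x \<Longrightarrow> c e \<noteq> l x"
    unfolding mu_admissible_def by (elim conjE bexE) blast
  \<comment> \<open>Empty values occur only at original vertices outside \<open>X\<close>, so
    domination has to be checked only where \<open>dom\<close> provides it.\<close>
  define f where "f = case_sum (\<lambda>a. if a \<in> X then {l a} else {}) (\<lambda>e. {c e})"
  have f_simps [simp]: "f (Inl a) = (if a \<in> X then {l a} else {})" "f (Inr e) = {c e}" for a e
    by (simp_all add: f_def)
  have "independent (subdivision Q) {v \<in> verts (subdivision Q). f v = {i}}" for i
    using ind by (auto simp: independent_subdivision_iff incident_edges_def split: if_splits)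
  moreover have "(\<Union>u\<in>neighbours (subdivision Q) v. f u) = {1..k}"
    if v: "v \<in> verts (subdivision Q)" "f v = {}" for v
  proof -
    from v obtain a where a: "v = Inl a" "a \<in> verts Q - X"
      by (auto split: if_splits)
    then show ?thesis
      using dom[OF a(2)] by (simp add: neighbours_subdivision_Inl) blast
  qed
  moreover have "f v \<subseteq> {1..k} \<and> card (f v) \<le> 1" if "v \<in> verts (subdivision Q)" for v
    using that c l by (auto simp: Pi_iff split: if_splits)
  ultimately have "RiDF k (subdivision Q) f"
    by (simp add: RiDF_def)
  moreover have "(\<Sum>a\<in>verts Q. card (f (Inl a))) = (\<Sum>a\<in>X. card (f (Inl a)))"
    using Q sub by (intro sum.mono_neutral_right) (auto simp: simple_graph_def)
  then have "weight (subdivision Q) f = card (edges Q) + card X"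
    by (simp add: weight_subdivision[OF Q])
  ultimately show thesis by (rule that)
qed

section \<open>Attained minima and the formula for the subdivision graph\<close>

lemma mu_le: "mu_admissible k Q X \<Longrightarrow> mu k Q \<le> card X"
  unfolding mu_def by (rule Least_le) blast

text \<open>The minimum is over a nonempty family: all of \<open>verts Q\<close> is admissible, with
  every edge coloured 1 and every vertex labelled 2, which takes two colours.\<close>

lemma mu_attained:
  assumes "k \<ge> 2"
  obtains X where "mu_admissible k Q X" "card X = mu k Q"
proof -
  have "\<exists>X. mu_admissible k Q X \<and> card X = mu k Q"
    unfolding mu_def by (rule LeastI) (use mu_admissible_verts[OF assms] in blast)
  then show thesis using that by blast
qed

lemma gamma_ri_le: "RiDF k G f \<Longrightarrow> gamma_ri k G \<le> weight G f"
  unfolding gamma_ri_def by (rule Least_le) blast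

lemma gamma_ri_attained:
  assumes "simple_graph G"
  obtains f where "RiDF k G f" "weight G f = gamma_ri k G"
proof -
  have "\<exists>w f. RiDF k G f \<and> weight G f = w" using ex_RiDF[OF assms] by blast
  then have "\<exists>f. RiDF k G f \<and> weight G f = gamma_ri k G"
    unfolding gamma_ri_def by (rule LeastI_ex)
  then show thesis using that by blast
qed

text \<open>Each translation turns an optimum on one side into a competitor on the other, with
  weight shifted by exactly \<open>card (edges Q)\<close>.\<close>

lemma gamma_ri_subdivision:
  assumes k: "k \<ge> 3" and Q: "simple_graph Q"
  shows "gamma_ri k (subdivision Q) = card (edges Q) + mu k Q"
proof (rule antisym)
  from k have "k \<ge> 2" by simp
  then obtain X where X: "mu_admissible k Q X" "card X = mu k Q"
    by (rule mu_attained)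
  obtain f where "RiDF k (subdivision Q) f" "weight (subdivision Q) f = card (edges Q) + card X"
    using Q X(1) by (rule mu_admissible_imp_RiDF_subdivision)
  then show "gamma_ri k (subdivision Q) \<le> card (edges Q) + mu k Q"
    using X(2) gamma_ri_le by metis
next
  obtain f where f: "RiDF k (subdivision Q) f" "weight (subdivision Q) f = gamma_ri k (subdivision Q)"
    using simple_graph_subdivision[OF Q] by (rule gamma_ri_attained)
  obtain X where "mu_admissible k Q X" "weight (subdivision Q) f = card (edges Q) + card X"
    using k Q f(1) by (rule RiDF_subdivision_imp_mu_admissible)
  then show "card (edges Q) + mu k Q \<le> gamma_ri k (subdivision Q)"
    using f(2) mu_le by fastforce
qed

lemma mu_eq_0_iff:
  assumes "k \<ge> 2" "simple_graph Q"
  shows "mu k Q = 0 \<longleftrightarrow> mu_admissible k Q {}"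
proof
  assume "mu k Q = 0"
  moreover obtain X where X: "mu_admissible k Q X" "card X = mu k Q"
    using assms(1) by (rule mu_attained)
  \<comment> \<open>Needed because \<open>card X = 0\<close> would also hold for an infinite
    \<open>X\<close>.\<close>
  moreover have "finite X"
    using X(1) assms(2) by (auto simp: mu_admissible_def simple_graph_def intro: finite_subset)
  ultimately show "mu_admissible k Q {}" by simp
next
  assume "mu_admissible k Q {}"
  then show "mu k Q = 0" using mu_le by fastforce
qed

section \<open>Proper edge colourings of regular graphs and the chromatic index\<close>

lemma proper_edge_colouring_inj_on_incident:
  assumes "proper_edge_colouring G m c"
  shows "inj_on c (incident_edges G v)"
  using assms unfolding proper_edge_colouring_def inj_on_def incident_edges_def by blast

text \<open>With \<open>k\<close> edges at each vertex and \<open>k\<close> colours, injectivity on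
  the incident edges is the same as surjectivity onto \<open>{1..k}\<close>. The right-hand side is
  what admissibility of the empty set demands of \<open>c\<close>.\<close>

lemma proper_edge_colouring_regular_iff:
  assumes G: "simple_graph G" "regular k G"
  shows "proper_edge_colouring G k c \<longleftrightarrow>
    c \<in> edges G \<rightarrow> {1..k} \<and> (\<forall>v\<in>verts G. c ` incident_edges G v = {1..k})"
proof -
  have fin: "finite (incident_edges G v)" for v
    using simple_graph_finite_edges[OF G(1)] by (simp add: incident_edges_def)
  have card: "card (incident_edges G v) = k" if "v \<in> verts G" for v
    using G that by (simp add: card_incident_edges regular_def)
  show ?thesis
  proof
    assume c: "proper_edge_colouring G k c"
    have "c ` incident_edges G v = {1..k}" if v: "v \<in> verts G" for v
    proof (rule card_subset_eq)
      show "c ` incident_edges G v \<subseteq> {1..k}"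
        using c by (auto simp: proper_edge_colouring_def incident_edges_def)
      show "card (c ` incident_edges G v) = card {1..k}"
        using card[OF v] proper_edge_colouring_inj_on_incident[OF c] by (simp add: card_image)
    qed simp
    with c show "c \<in> edges G \<rightarrow> {1..k} \<and> (\<forall>v\<in>verts G. c ` incident_edges G v = {1..k})"
      by (simp add: proper_edge_colouring_def)
  next
    assume c: "c \<in> edges G \<rightarrow> {1..k} \<and> (\<forall>v\<in>verts G. c ` incident_edges G v = {1..k})"
    have inj: "inj_on c (incident_edges G v)" if v: "v \<in> verts G" for v
      using c card[OF v] v fin by (intro eq_card_imp_inj_on) auto
    have "c e \<noteq> c e'" if e: "e \<in> edges G" "e' \<in> edges G" "e \<noteq> e'" "e \<inter> e' \<noteq> {}" for e e'
    proof -
      \<comment> \<open>Intersecting edges meet in a vertex, where local injectivity separates their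
        colours.\<close>
      from e obtain v where v: "v \<in> e" "v \<in> e'" by blast
      then have "v \<in> verts G" using e(1) G(1) by (auto simp: simple_graph_def)
      from inj[OF this] v e show ?thesis by (auto simp: inj_on_def incident_edges_def)
    qed
    with c show "proper_edge_colouring G k c" by (simp add: proper_edge_colouring_def)
  qed
qed

lemma proper_edge_colouring_ge_degree:
  assumes "simple_graph G" "proper_edge_colouring G m c"
  shows "card (neighbours G v) \<le> m"
proof -
  have "card (incident_edges G v) \<le> card {1..m}"
    using proper_edge_colouring_inj_on_incident[OF assms(2)]
    by (rule card_inj_on_le) (use assms(2) in \<open>auto simp: proper_edge_colouring_def incident_edges_def\<close>)
  then show ?thesis using assms(1) by (simp add: card_incident_edges)
qed

text \<open>A vertex of degree \<open>k\<close> forces at least \<open>k\<close> colours. The graph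
  without vertices has chromatic index 0, yet it is vacuously \<open>k\<close>-regular and
  \<open>k\<close>-colourable for every \<open>k\<close>; hence \<open>ne\<close>.\<close>

lemma chromatic_index_regular_eq_iff:
  assumes G: "simple_graph G" "regular k G" and ne: "verts G \<noteq> {}"
  shows "chromatic_index G = k \<longleftrightarrow> (\<exists>c. proper_edge_colouring G k c)"
proof
  assume "chromatic_index G = k"
  then show "\<exists>c. proper_edge_colouring G k c"
    using LeastI_ex[OF ex_proper_edge_colouring[OF G(1)]] by (simp add: chromatic_index_def)
next
  assume "\<exists>c. proper_edge_colouring G k c"
  moreover have "k \<le> m" if "\<exists>c. proper_edge_colouring G m c" for m
    using that ne G(2) proper_edge_colouring_ge_degree[OF G(1)] by (fastforce simp: regular_def)
  ultimately show "chromatic_index G = k"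
    unfolding chromatic_index_def by (rule Least_equality)
qed

lemma mu_eq_0_iff_proper_edge_colouring:
  assumes "k \<ge> 2" "simple_graph Q" "regular k Q"
  shows "mu k Q = 0 \<longleftrightarrow> (\<exists>c. proper_edge_colouring Q k c)"
  using assms by (auto simp: mu_eq_0_iff mu_admissible_def proper_edge_colouring_regular_iff)

theorem theorem5p1:
  fixes k :: nat and Q :: "'a ugraph"
  assumes "k \<ge> 3" and "simple_graph Q" and "regular k Q"
  shows "gamma_ri k (subdivision Q) = card (edges Q) + mu k Q
    \<and> delta k Q = int (mu k Q)
    \<and> (verts Q \<noteq> {} \<longrightarrow> (delta k Q = 0 \<longleftrightarrow> chromatic_index Q = k))
    \<and> 0 \<le> delta k Q \<and> delta k Q \<le> int (card (verts Q))"
proof -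
  have gamma: "gamma_ri k (subdivision Q) = card (edges Q) + mu k Q"
    using assms(1,2) by (rule gamma_ri_subdivision)
  then have "delta k Q = int (mu k Q)"
    by (simp add: delta_def)
  \<comment> \<open>The upper bound on \<open>delta\<close> comes from the largest candidate,
    \<open>X = verts Q\<close>.\<close>
  moreover have "mu k Q \<le> card (verts Q)"
    using assms(1) by (intro mu_le mu_admissible_verts) simp
  moreover have "mu k Q = 0 \<longleftrightarrow> chromatic_index Q = k" if "verts Q \<noteq> {}"
    using assms that by (simp add: mu_eq_0_iff_proper_edge_colouring chromatic_index_regular_eq_iff)
  ultimately show ?thesis using gamma by simp
qed

end
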